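(* Let $X$ be a nonempty finite or countably infinite set. (1) Let $\sigma \in \mathrm{Perm}(X)$ be a permutation of finite type. For every positive integer $\ell$, \[ F_X(\sigma^{\ell}) = \sum_{\substack{k=1 \\ k \mid \ell}}^{\ell} k\, C_{\sigma}(k). \] (2) Let $\sigma \in \mathrm{Perm}(X)$ be a permutation of finite type and finite multiplicity. For every positive integer $\ell$, \[ C_{\sigma}(\ell) = \frac{1}{\ell} \sum_{\substack{k=1 \\ k \mid \ell}}^{\ell} \mu\left(\frac{\ell}{k}\right) F_X(\sigma^k), \] where $\mu$ is the Möbius function. (3) Thus the fixed point counting function of a permutation of finite type and finite multiplicity determines the conjugacy class of the permutation: if $\sigma, \tau \in \mathrm{Perm}(X)$ are both of finite type and finite multiplicity and $F_X(\sigma^k) = F_X(\tau^k)$ for all positive integers $k$, then $\sigma$ and $\tau$ are conjugate.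
   Context: $\mathrm{Perm}(X)$ is the group of permutations of $X$. $\mathbf{N} = \{1,2,3,\ldots\}$ and $\mathbf{N}_0 = \mathbf{N} \cup \{0\}$. Every $\sigma \in \mathrm{Perm}(X)$ has a unique decomposition as a product of pairwise disjoint cycles of finite length (length $\ell \in \mathbf{N}$, with fixed points being cycles of length $1$) or infinite length (cycles $(\ldots,x_{-1},x_0,x_1,\ldots)$ with distinct $x_i$, $i \in \mathbf{Z}$, and $\sigma(x_i)=x_{i+1}$). For $\ell \in \mathbf{N} \cup \{\infty\}$, $C_\sigma(\ell) \in \mathbf{N}_0 \cup \{\infty\}$ is the number of cycles of length $\ell$ in this decomposition. $\sigma$ is of finite type if $C_\sigma(\infty) = 0$. $\sigma$ has finite multiplicity if $C_\sigma(\ell) < \infty$ for all $\ell \in \mathbf{N}$. Permutations $\sigma,\tau \in \mathrm{Perm}(X)$ are conjugate if $C_\sigma(\ell) = C_\tau(\ell)$ for all $\ell \in \mathbf{N} \cup \{\infty\}$. $F_X(\sigma^k) \in \mathbf{N}_0 \cup \{\infty\}$ is the number of $x \in X$ with $\sigma^k(x) = x$; the function $k \mapsto F_X(\sigma^k)$ on $\mathbf{N}$ is the fixed point counting function of $\sigma$. Sums and products are taken in $\mathbf{N}_0 \cup \{\infty\}$ with $k \cdot \infty = \infty$ for $k \in \mathbf{N}$. *)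

theory Defs
  imports
    Complex_Main
    "HOL-Library.Extended_Nat"
    "HOL-Library.Countable_Set"
    "HOL-Library.Disjoint_Sets"
    "HOL-Combinatorics.Permutations"
    "HOL-Computational_Algebra.Squarefree"
begin

definition ecard :: "'a set \<Rightarrow> enat" where
  "ecard A = (if finite A then enat (card A) else \<infinity>)"

text \<open>
  A permutation of \<open>X\<close> is a function \<open>\<sigma>\<close> with \<open>\<sigma> permutes X\<close>; it is the identity outside \<open>X\<close>, so
  everything below is relativised to \<open>X\<close>. A cycle occurring in the decomposition of \<open>\<sigma>\<close> is the
  restriction of \<open>\<sigma>\<close> to the set of entries of the cycle, and is represented by this set; this
  way the fixed points of \<open>\<sigma>\<close> in \<open>X\<close> give distinct cycles of length 1.
  Lemmas \<open>cycles_partition\<close> and \<open>cycle_decomposition_unique\<close> justify the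
  representation.
\<close>

definition is_finite_cycle :: "'a set \<Rightarrow> ('a \<Rightarrow> 'a) \<Rightarrow> nat \<Rightarrow> 'a set \<Rightarrow> bool" where
  "is_finite_cycle X \<sigma> n S \<longleftrightarrow> n \<ge> 1 \<and> S \<subseteq> X \<and>
     (\<exists>x :: nat \<Rightarrow> 'a. inj_on x {..<n} \<and> S = x ` {..<n} \<and> (\<forall>i<n. \<sigma> (x i) = x (Suc i mod n)))"

definition is_infinite_cycle :: "'a set \<Rightarrow> ('a \<Rightarrow> 'a) \<Rightarrow> 'a set \<Rightarrow> bool" where
  "is_infinite_cycle X \<sigma> S \<longleftrightarrow> S \<subseteq> X \<and>
     (\<exists>x :: int \<Rightarrow> 'a. inj x \<and> S = range x \<and> (\<forall>i. \<sigma> (x i) = x (i + 1)))"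

definition is_cycle :: "'a set \<Rightarrow> ('a \<Rightarrow> 'a) \<Rightarrow> enat \<Rightarrow> 'a set \<Rightarrow> bool" where
  "is_cycle X \<sigma> l S \<longleftrightarrow>
     (case l of enat n \<Rightarrow> is_finite_cycle X \<sigma> n S | \<infinity> \<Rightarrow> is_infinite_cycle X \<sigma> S)"

definition cycle_count :: "'a set \<Rightarrow> ('a \<Rightarrow> 'a) \<Rightarrow> enat \<Rightarrow> enat" where
  "cycle_count X \<sigma> l = ecard {S. is_cycle X \<sigma> l S}"

definition finite_type :: "'a set \<Rightarrow> ('a \<Rightarrow> 'a) \<Rightarrow> bool" where
  "finite_type X \<sigma> \<longleftrightarrow> cycle_count X \<sigma> \<infinity> = 0"

definition finite_multiplicity :: "'a set \<Rightarrow> ('a \<Rightarrow> 'a) \<Rightarrow> bool" where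
  "finite_multiplicity X \<sigma> \<longleftrightarrow> (\<forall>n\<ge>1. cycle_count X \<sigma> (enat n) < \<infinity>)"

definition conjugate :: "'a set \<Rightarrow> ('a \<Rightarrow> 'a) \<Rightarrow> ('a \<Rightarrow> 'a) \<Rightarrow> bool" where
  "conjugate X \<sigma> \<tau> \<longleftrightarrow> (\<forall>l\<ge>1. cycle_count X \<sigma> l = cycle_count X \<tau> l)"

definition fixed_point_count :: "'a set \<Rightarrow> ('a \<Rightarrow> 'a) \<Rightarrow> enat" where
  "fixed_point_count X f = ecard {x \<in> X. f x = x}"

definition moebius_mu :: "nat \<Rightarrow> int" where
  "moebius_mu n = (if squarefree n then (- 1) ^ card (prime_factors n) else 0)"


lemma finite_cycle_card:
  assumes "is_finite_cycle X \<sigma> n S"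
  shows "finite S" and "card S = n"
proof -
  obtain x :: "nat \<Rightarrow> 'a" where "inj_on x {..<n}" "S = x ` {..<n}"
    using assms unfolding is_finite_cycle_def by blast
  then show "finite S" "card S = n" by (simp_all add: card_image)
qed

lemma infinite_cycle_infinite:
  assumes "is_infinite_cycle X \<sigma> S"
  shows "infinite S"
proof -
  obtain x :: "int \<Rightarrow> 'a" where "inj x" "S = range x"
    using assms unfolding is_infinite_cycle_def by blast
  then show ?thesis by (metis finite_imageD infinite_UNIV_int)
qed

lemma cycle_length_unique:
  assumes "is_cycle X \<sigma> l S" and "is_cycle X \<sigma> l' S"
  shows "l = l'"
proof -
  have *: "m = ecard S" if "is_cycle X \<sigma> m S" for m
    using that finite_cycle_card[of X \<sigma> _ S] infinite_cycle_infinite[of X \<sigma> S]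
    by (cases m) (simp_all add: is_cycle_def ecard_def)
  show ?thesis using *[OF assms(1)] *[OF assms(2)] by (rule trans[OF _ sym])
qed

lemma cycle_eq_orbit:
  assumes inj: "inj \<sigma>" and S: "is_cycle X \<sigma> l S" and a: "a \<in> S"
  shows "S = {b. \<exists>m n. (\<sigma> ^^ m) a = (\<sigma> ^^ n) b}"
proof (cases l)
  case (enat n)
  obtain x where n: "n \<ge> 1" and S_eq: "S = x ` {..<n}"
    and step: "\<And>i. i < n \<Longrightarrow> \<sigma> (x i) = x (Suc i mod n)"
    using S enat by (auto simp: is_cycle_def is_finite_cycle_def)
  have pow: "(\<sigma> ^^ m) (x (i mod n)) = x ((i + m) mod n)" for m i
  proof (induction m)
    case (Suc m)
    have "(i + m) mod n < n" using n by simp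
    then show ?case using Suc step by (simp add: mod_Suc_eq)
  qed simp
  obtain i where i: "i < n" "a = x i" using a S_eq by auto
  show ?thesis
  proof (intro set_eqI iffI)
    fix b assume "b \<in> S"
    then obtain j where j: "j < n" "b = x j" using S_eq by auto
    have "(\<sigma> ^^ (n + j - i)) (x (i mod n)) = x ((i + (n + j - i)) mod n)" by (rule pow)
    also have "\<dots> = x j" using i j by simp
    finally have "(\<sigma> ^^ (n + j - i)) a = (\<sigma> ^^ 0) b" using i j by simp
    then show "b \<in> {b. \<exists>m n. (\<sigma> ^^ m) a = (\<sigma> ^^ n) b}" by blast
  next
    fix b assume "b \<in> {b. \<exists>m n. (\<sigma> ^^ m) a = (\<sigma> ^^ n) b}"
    then obtain p q where pq: "(\<sigma> ^^ p) a = (\<sigma> ^^ q) b" by blast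
    let ?j = "i + p + (n - 1) * q"
    have "(\<sigma> ^^ q) (x (?j mod n)) = x ((?j + q) mod n)" by (rule pow)
    also have "?j + q = (i + p) + n * q" using n by (cases n) simp_all
    also have "x (\<dots> mod n) = (\<sigma> ^^ p) a" using pow[of p i] i by simp
    finally have "(\<sigma> ^^ q) (x (?j mod n)) = (\<sigma> ^^ q) b" using pq by simp
    then have "x (?j mod n) = b" by (rule injD[OF inj_fn[OF inj]])
    then show "b \<in> S" using S_eq n by force
  qed
next
  case infinity
  obtain x where S_eq: "S = range x" and step: "\<And>i::int. \<sigma> (x i) = x (i + 1)"
    using S infinity by (auto simp: is_cycle_def is_infinite_cycle_def)
  have pow: "(\<sigma> ^^ m) (x i) = x (i + int m)" for m i
    by (induction m) (simp_all add: step algebra_simps)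
  obtain i where i: "a = x i" using a S_eq by auto
  show ?thesis
  proof (intro set_eqI iffI)
    fix b assume "b \<in> S"
    then obtain j where j: "b = x j" using S_eq by auto
    have "(\<sigma> ^^ nat (j - i)) a = (\<sigma> ^^ nat (i - j)) b" using i j by (cases "i \<le> j") (simp_all add: pow)
    then show "b \<in> {b. \<exists>m n. (\<sigma> ^^ m) a = (\<sigma> ^^ n) b}" by blast
  next
    fix b assume "b \<in> {b. \<exists>m n. (\<sigma> ^^ m) a = (\<sigma> ^^ n) b}"
    then obtain p q where "(\<sigma> ^^ p) a = (\<sigma> ^^ q) b" by blast
    then have "(\<sigma> ^^ q) (x (i + int p - int q)) = (\<sigma> ^^ q) b" using i by (simp add: pow)
    then have "x (i + int p - int q) = b" by (rule injD[OF inj_fn[OF inj]])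
    then show "b \<in> S" using S_eq by blast
  qed
qed

lemma cycle_exists:
  assumes \<sigma>: "\<sigma> permutes X" and a: "a \<in> X"
  shows "\<exists>l S. is_cycle X \<sigma> l S \<and> a \<in> S"
proof (cases "\<exists>n>0. (\<sigma> ^^ n) a = a")
  case True
  define n where "n = (LEAST n. n > 0 \<and> (\<sigma> ^^ n) a = a)"
  have n: "n > 0" "(\<sigma> ^^ n) a = a" using LeastI_ex[OF True] by (simp_all add: n_def)
  have least: "n \<le> m" if "m > 0" "(\<sigma> ^^ m) a = a" for m
    unfolding n_def by (rule Least_le) (use that in simp)
  define x where "x = (\<lambda>i. (\<sigma> ^^ i) a)"
  have "inj_on x {..<n}"
  proof (rule linorder_inj_onI')
    fix i j assume ij: "i \<in> {..<n}" "j \<in> {..<n}" "i < j"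
    show "x i \<noteq> x j"
    proof
      assume "x i = x j"
      moreover have "x j = (\<sigma> ^^ i) ((\<sigma> ^^ (j - i)) a)"
        using ij funpow_add[of i "j - i" \<sigma>] by (simp add: x_def)
      ultimately have "(\<sigma> ^^ i) ((\<sigma> ^^ (j - i)) a) = (\<sigma> ^^ i) a"
        by (simp add: x_def)
      then have "(\<sigma> ^^ (j - i)) a = a" by (rule injD[OF inj_fn[OF permutes_inj[OF \<sigma>]]])
      then show False using least[of "j - i"] ij by auto
    qed
  qed
  moreover have "\<sigma> (x i) = x (Suc i mod n)" if "i < n" for i
  proof (cases "Suc i = n")
    case True
    then have "\<sigma> (x i) = (\<sigma> ^^ n) a" by (auto simp: x_def)
    then show ?thesis using True n by (simp add: x_def)
  qed (use that in \<open>simp add: x_def\<close>)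
  moreover have "x i \<in> X" for i
    by (induction i) (simp_all add: x_def a permutes_in_image[OF \<sigma>])
  ultimately have "is_finite_cycle X \<sigma> n (x ` {..<n})"
    using n unfolding is_finite_cycle_def by (auto intro!: exI[of _ x])
  moreover have "a = x 0" by (simp add: x_def)
  ultimately show ?thesis using n
    by (intro exI[of _ "enat n"] exI[of _ "x ` {..<n}"]) (auto simp: is_cycle_def)
next
  case False
  define x where
    "x = (\<lambda>i::int. if i \<ge> 0 then (\<sigma> ^^ nat i) a else (inv \<sigma> ^^ nat (- i)) a)"
  have x_neg: "x (- int m) = (inv \<sigma> ^^ m) a" for m
    by (cases "m = 0") (simp_all add: x_def)
  have step: "\<sigma> (x i) = x (i + 1)" for i
  proof -
    consider "i \<ge> 0" | "i < 0" by linarith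
    then show ?thesis
    proof cases
      case 1
      then show ?thesis by (simp add: x_def nat_add_distrib)
    next
      case 2
      define m where "m = nat (- i - 1)"
      have i: "i = - int (Suc m)" using 2 by (simp add: m_def)
      have "\<sigma> (x i) = \<sigma> ((inv \<sigma> ^^ Suc m) a)" unfolding i x_neg ..
      also have "\<dots> = (inv \<sigma> ^^ m) a" by (simp add: permutes_inverses[OF \<sigma>])
      also have "\<dots> = x (i + 1)" using i by (simp flip: x_neg)
      finally show ?thesis .
    qed
  qed
  have pow: "(\<sigma> ^^ m) (x i) = x (i + int m)" for m i
    by (induction m) (simp_all add: step algebra_simps)
  have shift: "x i = x (i + d) \<longleftrightarrow> x 0 = x d" for i d
  proof (induction i rule: int_induct[where k = 0])
    case (step1 i)
    have "x (i + 1) = x (i + 1 + d) \<longleftrightarrow> \<sigma> (x i) = \<sigma> (x (i + d))" by (simp add: step algebra_simps)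
    then show ?case using step1 by (simp only: inj_eq[OF permutes_inj[OF \<sigma>]])
  next
    case (step2 i)
    have "x i = x (i + d) \<longleftrightarrow> \<sigma> (x (i - 1)) = \<sigma> (x (i - 1 + d))" by (simp add: step algebra_simps)
    then show ?case using step2 by (simp only: inj_eq[OF permutes_inj[OF \<sigma>]])
  qed simp
  have "inj x"
  proof (rule linorder_injI)
    fix i j :: int assume ij: "i < j"
    have "(\<sigma> ^^ nat (j - i)) a \<noteq> a"
      using False ij by (metis diff_gt_0_iff_gt zero_less_nat_eq)
    then have "x 0 \<noteq> x (j - i)" using ij by (simp add: x_def)
    then show "x i \<noteq> x j" using shift[of i "j - i"] by simp
  qed
  moreover have "x i \<in> X" for i
  proof -
    have "(\<sigma> ^^ m) a \<in> X" "(inv \<sigma> ^^ m) a \<in> X" for m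
      by (induction m) (simp_all add: a permutes_in_image[OF \<sigma>] permutes_in_image[OF permutes_inv[OF \<sigma>]])
    then show ?thesis by (simp add: x_def)
  qed
  ultimately have "is_infinite_cycle X \<sigma> (range x)"
    unfolding is_infinite_cycle_def using step by blast
  moreover have "a = x 0" by (simp add: x_def)
  ultimately show ?thesis
    by (intro exI[of _ \<infinity>] exI[of _ "range x"]) (auto simp: is_cycle_def)
qed

lemma cycles_partition:
  assumes \<sigma>: "\<sigma> permutes X"
  shows "partition_on X {S. \<exists>l. is_cycle X \<sigma> l S}"
proof (rule partition_onI)
  have sub: "S \<subseteq> X \<and> S \<noteq> {}" if "is_cycle X \<sigma> l S" for l S
    using that unfolding is_cycle_def is_finite_cycle_def is_infinite_cycle_def
    by (cases l) (force simp: lessThan_empty_iff)+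
  show "\<Union> {S. \<exists>l. is_cycle X \<sigma> l S} = X" using sub cycle_exists[OF \<sigma>] by blast
  show "{} \<notin> {S. \<exists>l. is_cycle X \<sigma> l S}" using sub by blast
  fix S T assume ST: "S \<in> {S. \<exists>l. is_cycle X \<sigma> l S}" "T \<in> {S. \<exists>l. is_cycle X \<sigma> l S}" "S \<noteq> T"
  then obtain l l' where "is_cycle X \<sigma> l S" "is_cycle X \<sigma> l' T" by blast
  note cyc = this
  have "a \<notin> T" if "a \<in> S" for a
  proof
    assume "a \<in> T"
    then have "S = T"
      by (rule trans[OF cycle_eq_orbit[OF permutes_inj[OF \<sigma>] cyc(1) that]
            cycle_eq_orbit[OF permutes_inj[OF \<sigma>] cyc(2), symmetric]])
    then show False using ST(3) by simp
  qed
  then show "disjnt S T" by (auto simp: disjnt_iff)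
qed

lemma cycle_decomposition_unique:
  assumes \<sigma>: "\<sigma> permutes X" and P: "partition_on X P" and cyc: "\<forall>S\<in>P. \<exists>l. is_cycle X \<sigma> l S"
  shows "P = {S. \<exists>l. is_cycle X \<sigma> l S}"
proof (intro equalityI subsetI)
  fix S assume S: "S \<in> {S. \<exists>l. is_cycle X \<sigma> l S}"
  have "S \<noteq> {}" "S \<subseteq> X"
    using S cycles_partition[OF \<sigma>] by (auto simp: partition_on_def)
  then obtain a T where "a \<in> S" "a \<in> T" "T \<in> P" using P unfolding partition_on_def by blast
  note aT = this
  then obtain l l' where "is_cycle X \<sigma> l S" "is_cycle X \<sigma> l' T" using S cyc by blast
  then have "S = T"
    using aT(1,2) cycle_eq_orbit[OF permutes_inj[OF \<sigma>], of X l S a]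
      cycle_eq_orbit[OF permutes_inj[OF \<sigma>], of X l' T a] by simp
  then show "S \<in> P" using aT(3) by simp
qed (use cyc in auto)

end

theory Submission
  imports Defs
begin

text \<open>
  A point of \<open>X\<close> is fixed by \<open>\<sigma> ^^ l\<close> exactly when it lies on a cycle of some finite length
  dividing \<open>l\<close>; the cycles of length \<open>k\<close> are disjoint with \<open>k\<close> elements each, which gives (1).
  Moebius inversion turns (1) into (2), and (2) expresses every cycle count through the fixed
  point counts, which gives (3).
\<close>

section \<open>Cardinalities of disjoint unions in \<open>enat\<close>\<close>

lemma ecard_UN_disjoint:
  assumes "finite I" and "disjoint_family_on A I"
  shows "ecard (\<Union>i\<in>I. A i) = (\<Sum>i\<in>I. ecard (A i))"
  using assms
proof (induction I)
  case empty
  then show ?case by (simp add: ecard_def zero_enat_def)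
next
  case (insert i I)
  have disj: "A i \<inter> (\<Union>j\<in>I. A j) = {}"
    using insert.prems insert.hyps by (auto simp: disjoint_family_on_def)
  have "ecard (A i \<union> (\<Union>j\<in>I. A j)) = ecard (A i) + ecard (\<Union>j\<in>I. A j)"
    using disj by (auto simp: ecard_def card_Un_disjoint simp del: finite_UN)
  moreover have "disjoint_family_on A I"
    using insert.prems by (auto simp: disjoint_family_on_def)
  ultimately show ?case using insert by simp
qed

text \<open>Source of the terms \<open>enat k * cycle_count X \<sigma> (enat k)\<close>. For
  infinitely many blocks both sides are infinite: a finite union has only finitely many subsets, and
  a positive \<open>k\<close> times infinity is infinity.\<close>

lemma ecard_Union_uniform:
  assumes "disjoint \<S>" and "\<And>S. S \<in> \<S> \<Longrightarrow> finite S \<and> card S = k" and "k \<ge> 1"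
  shows "ecard (\<Union>\<S>) = enat k * ecard \<S>"
proof (cases "finite \<S>")
  case True
  have "card (\<Union>\<S>) = (\<Sum>S\<in>\<S>. card S)"
    using assms by (intro card_Union_disjoint) (auto simp: disjoint_def pairwise_def disjnt_def)
  then have "card (\<Union>\<S>) = k * card \<S>" using assms(2) by simp
  moreover have "finite (\<Union>\<S>)" using True assms(2) by blast
  ultimately show ?thesis using True by (simp add: ecard_def)
next
  case False
  then have "infinite (\<Union>\<S>)" using finite_UnionD by blast
  then show ?thesis using False assms(3) by (simp add: ecard_def imult_is_infinity enat_0_iff)
qed

section \<open>Fixed points of powers, cycle by cycle\<close>

text \<open>The power shifts indices by \<open>l\<close> modulo \<open>n\<close>, and the numbering
  is injective on \<open>{..<n}\<close>, so a point returns exactly when \<open>l\<close> is 0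
  modulo \<open>n\<close>.\<close>

lemma finite_cycle_funpow_fixes_iff:
  assumes "is_finite_cycle X \<sigma> n S" and "a \<in> S"
  shows "(\<sigma> ^^ l) a = a \<longleftrightarrow> n dvd l"
proof -
  obtain x where n: "n \<ge> 1" and S: "S = x ` {..<n}" and inj: "inj_on x {..<n}"
    and step: "\<And>i. i < n \<Longrightarrow> \<sigma> (x i) = x (Suc i mod n)"
    using assms(1) by (auto simp: is_finite_cycle_def)
  obtain i where i: "i < n" "a = x i" using assms(2) S by auto
  have "(\<sigma> ^^ m) (x i) = x ((i + m) mod n)" for m
  proof (induction m)
    case (Suc m)
    have "(i + m) mod n < n" using n by simp
    then show ?case using Suc step by (simp add: mod_Suc_eq)
  qed (use i in simp)
  then have "(\<sigma> ^^ l) a = a \<longleftrightarrow> x ((i + l) mod n) = x i" using i by simp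
  also have "\<dots> \<longleftrightarrow> (i + l) mod n = i" using i n by (simp add: inj_on_eq_iff[OF inj])
  also have "\<dots> \<longleftrightarrow> (i + l) mod n = i mod n" using i by simp
  also have "\<dots> \<longleftrightarrow> n dvd l" by (metis add_diff_cancel_left' le_add1 mod_eq_dvd_iff_nat)
  finally show ?thesis .
qed

lemma infinite_cycle_funpow_not_fixes:
  assumes "is_infinite_cycle X \<sigma> S" and "a \<in> S" and "l \<ge> 1"
  shows "(\<sigma> ^^ l) a \<noteq> a"
proof -
  obtain x where S: "S = range x" and inj: "inj x" and step: "\<And>i::int. \<sigma> (x i) = x (i + 1)"
    using assms(1) by (auto simp: is_infinite_cycle_def)
  have pow: "(\<sigma> ^^ m) (x i) = x (i + int m)" for m i
    by (induction m) (simp_all add: step algebra_simps)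
  show ?thesis using assms(2,3) S inj by (auto simp: pow inj_eq)
qed

text \<open>Every point lies on some cycle. On a finite one divisibility decides; an infinite one
  has no point fixed by a positive power.\<close>

lemma fixed_points_eq_Union_cycles:
  assumes \<sigma>: "\<sigma> permutes X" and l: "l \<ge> 1"
  shows "{x \<in> X. (\<sigma> ^^ l) x = x} = (\<Union>k\<in>{k. k dvd l}. \<Union>{S. is_finite_cycle X \<sigma> k S})"
proof (intro equalityI subsetI)
  fix a assume a: "a \<in> {x \<in> X. (\<sigma> ^^ l) x = x}"
  then obtain m S where S: "is_cycle X \<sigma> m S" "a \<in> S" using cycle_exists[OF \<sigma>, of a] by blast
  show "a \<in> (\<Union>k\<in>{k. k dvd l}. \<Union>{S. is_finite_cycle X \<sigma> k S})"
  proof (cases m)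
    case (enat n)
    then have fin: "is_finite_cycle X \<sigma> n S" using S by (simp add: is_cycle_def)
    then have "n dvd l" using finite_cycle_funpow_fixes_iff[OF fin S(2)] a by simp
    then show ?thesis using fin S(2) by blast
  next
    case infinity
    then show ?thesis
      using infinite_cycle_funpow_not_fixes[of X \<sigma> S a l] S a l by (simp add: is_cycle_def)
  qed
next
  fix a assume "a \<in> (\<Union>k\<in>{k. k dvd l}. \<Union>{S. is_finite_cycle X \<sigma> k S})"
  then obtain k S where "k dvd l" "is_finite_cycle X \<sigma> k S" "a \<in> S" by blast
  moreover from this have "a \<in> X" by (auto simp: is_finite_cycle_def)
  ultimately show "a \<in> {x \<in> X. (\<sigma> ^^ l) x = x}" by (simp add: finite_cycle_funpow_fixes_iff)
qed

text \<open>The union of cycles is counted in two layers, first by length and then by cycle. Both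
  layers are disjoint because cycles with a common point coincide.\<close>

lemma fixed_point_count_eq_divisor_sum:
  assumes \<sigma>: "\<sigma> permutes X" and l: "l \<ge> 1"
  shows "fixed_point_count X (\<sigma> ^^ l) = (\<Sum>k | k dvd l. enat k * cycle_count X \<sigma> (enat k))"
proof -
  let ?C = "\<lambda>k. {S. is_finite_cycle X \<sigma> k S}"
  have cyc: "is_cycle X \<sigma> (enat k) S" if "is_finite_cycle X \<sigma> k S" for k S
    using that by (simp add: is_cycle_def)
  \<comment> \<open>Both cycles equal the orbit of \<open>a\<close>.\<close>
  have meet: "S = T" if "is_finite_cycle X \<sigma> k S" "is_finite_cycle X \<sigma> k' T" "a \<in> S" "a \<in> T"
    for k k' S T a
    by (rule trans[OF cycle_eq_orbit[OF permutes_inj[OF \<sigma>] cyc[OF that(1)] that(3)]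
          cycle_eq_orbit[OF permutes_inj[OF \<sigma>] cyc[OF that(2)] that(4), symmetric]])
  \<comment> \<open>Otherwise a single set would be a cycle of both lengths, but the length is its
    cardinality.\<close>
  have "a \<notin> \<Union>(?C k')" if "k \<noteq> k'" "a \<in> \<Union>(?C k)" for k k' a
    using that meet[of k _ k' _ a] finite_cycle_card(2) by blast
  then have "disjoint_family_on (\<lambda>k. \<Union>(?C k)) {k. k dvd l}"
    unfolding disjoint_family_on_def by blast
  moreover have "finite {k. k dvd l}" using l by (intro finite_divisors_nat) simp
  ultimately have "fixed_point_count X (\<sigma> ^^ l) = (\<Sum>k | k dvd l. ecard (\<Union>(?C k)))"
    unfolding fixed_point_count_def fixed_points_eq_Union_cycles[OF assms]
    by (rule ecard_UN_disjoint[rotated])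
  also have "\<dots> = (\<Sum>k | k dvd l. enat k * cycle_count X \<sigma> (enat k))"
  proof (rule sum.cong[OF refl])
    fix k assume "k \<in> {k. k dvd l}"
    then have "k \<ge> 1" using l by (cases k) auto
    moreover have "disjoint (?C k)" unfolding disjoint_def using meet by blast
    ultimately have "ecard (\<Union>(?C k)) = enat k * ecard (?C k)"
      by (intro ecard_Union_uniform) (auto dest: finite_cycle_card)
    then show "ecard (\<Union>(?C k)) = enat k * cycle_count X \<sigma> (enat k)"
      by (simp add: cycle_count_def is_cycle_def)
  qed
  finally show ?thesis .
qed

section \<open>The Moebius function and inversion\<close>

text \<open>As \<open>p\<close> is coprime to \<open>d\<close>, the product is squarefree exactly
  when \<open>d\<close> is, and it has one more prime factor, which flips the sign. If
  \<open>d\<close> is not squarefree, both sides are 0.\<close>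

lemma moebius_mu_prime_mult:
  assumes p: "prime p" and "\<not> p dvd d"
  shows "moebius_mu (p * d) = - moebius_mu d"
proof -
  have d: "d \<noteq> 0" using assms(2) by (cases d) auto
  have cop: "coprime p d" using assms prime_imp_coprime by blast
  then have "squarefree (p * d) \<longleftrightarrow> squarefree d"
    using squarefree_mult_coprime[OF cop] squarefree_prime[OF p] squarefree_multD(2) by blast
  moreover have "card (prime_factors (p * d)) = Suc (card (prime_factors d))"
  proof -
    have "prime_factors (p * d) = insert p (prime_factors d)"
      using p d by (simp add: prime_factors_product prime_prime_factors prime_gt_0_nat)
    moreover have "p \<notin> prime_factors d" using assms(2) by (auto dest: in_prime_factors_imp_dvd)
    ultimately show ?thesis by simp
  qed
  ultimately show ?thesis by (simp add: moebius_mu_def)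
qed

text \<open>For a prime \<open>p\<close> dividing \<open>n\<close>, the squarefree divisors \<open>d\<close> and \<open>p * d\<close> with \<open>p\<close> not dividing
  \<open>d\<close> cancel.\<close>

lemma sum_moebius_mu_divisors:
  assumes n: "n > 0"
  shows "(\<Sum>d | d dvd n. moebius_mu d) = (if n = 1 then 1 else 0)"
proof (cases "n = 1")
  case True
  then show ?thesis by (simp add: moebius_mu_def)
next
  case False
  then obtain p where p: "prime p" "p dvd n" using prime_factor_nat by blast
  define A where "A = {d. squarefree d \<and> d dvd n \<and> \<not> p dvd d}"
  have fin: "finite {d. d dvd n}" using n by simp
  then have finA: "finite A" by (rule rev_finite_subset) (auto simp: A_def)
  have "{d. d dvd n \<and> squarefree d} = A \<union> (*) p ` A"
  proof (intro equalityI subsetI)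
    fix d assume d: "d \<in> {d. d dvd n \<and> squarefree d}"
    show "d \<in> A \<union> (*) p ` A"
    proof (cases "p dvd d")
      case True
      then obtain e where e: "d = p * e" by (elim dvdE)
      have "squarefree e" using d e squarefree_multD(2) by blast
      moreover have "\<not> p dvd e"
      proof
        assume "p dvd e"
        then have "p\<^sup>2 dvd d" by (simp add: e power2_eq_square)
        then have "is_unit p" using d squarefreeD by blast
        then show False using p by auto
      qed
      moreover have "e dvd n" using d e dvd_mult_right by blast
      ultimately show ?thesis using e by (auto simp: A_def)
    qed (use d in \<open>auto simp: A_def\<close>)
  next
    fix d assume "d \<in> A \<union> (*) p ` A"
    \<comment> \<open>Coprimality of \<open>p\<close> and \<open>e\<close> gives both the
      divisibility and the squarefreeness of the product.\<close>
    moreover have "p * e dvd n \<and> squarefree (p * e)" if "e \<in> A" for e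
    proof -
      have "coprime p e" using that p by (auto simp: A_def prime_imp_coprime)
      then show ?thesis using that p
        by (auto simp: A_def divides_mult squarefree_mult_coprime squarefree_prime)
    qed
    ultimately show "d \<in> {d. d dvd n \<and> squarefree d}" by (auto simp: A_def)
  qed
  moreover have "(\<Sum>d | d dvd n. moebius_mu d) = (\<Sum>d | d dvd n \<and> squarefree d. moebius_mu d)"
    by (rule sum.mono_neutral_right) (auto simp: moebius_mu_def fin)
  ultimately have "(\<Sum>d | d dvd n. moebius_mu d) = sum moebius_mu (A \<union> (*) p ` A)" by simp
  also have "\<dots> = sum moebius_mu A + sum moebius_mu ((*) p ` A)"
    by (intro sum.union_disjoint finite_imageI finA) (auto simp: A_def)
  also have "sum moebius_mu ((*) p ` A) = (\<Sum>d\<in>A. moebius_mu (p * d))"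
    using prime_gt_0_nat[OF p(1)] by (subst sum.reindex) (auto intro: inj_onI)
  also have "\<dots> = - sum moebius_mu A"
    by (simp add: A_def moebius_mu_prime_mult[OF p(1)] sum_negf)
  finally show ?thesis using False by simp
qed

lemma moebius_inversion:
  fixes f g :: "nat \<Rightarrow> 'a::comm_ring_1"
  assumes g: "\<And>k. k > 0 \<Longrightarrow> g k = (\<Sum>d | d dvd k. f d)" and l: "l > 0"
  shows "(\<Sum>k | k dvd l. of_int (moebius_mu (l div k)) * g k) = f l"
proof -
  let ?D = "{k. k dvd l}" and ?mu = "\<lambda>k. of_int (moebius_mu (l div k)) :: 'a"
  have fin: "finite ?D" using l by simp
  have "(\<Sum>k\<in>?D. ?mu k * g k) = (\<Sum>k\<in>?D. \<Sum>d | d \<in> ?D \<and> d dvd k. ?mu k * f d)"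
  proof (rule sum.cong[OF refl])
    fix k assume k: "k \<in> ?D"
    \<comment> \<open>Divisors of \<open>k\<close> already divide \<open>l\<close>; naming
      \<open>?D\<close> for both indices brings the double sum into the form that
      \<open>sum.swap_restrict\<close> exchanges.\<close>
    then have "{d. d \<in> ?D \<and> d dvd k} = {d. d dvd k}" by (auto intro: dvd_trans)
    moreover have "k > 0" using k l by (auto intro: Nat.gr0I)
    ultimately show "?mu k * g k = (\<Sum>d | d \<in> ?D \<and> d dvd k. ?mu k * f d)"
      by (simp add: g sum_distrib_left)
  qed
  also have "\<dots> = (\<Sum>d\<in>?D. \<Sum>k | k \<in> ?D \<and> d dvd k. ?mu k * f d)"
    by (rule sum.swap_restrict[OF fin fin])
  also have "\<dots> = (\<Sum>d\<in>?D. if d = l then f d else 0)"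
  proof (rule sum.cong[OF refl])
    fix d assume d: "d \<in> ?D"
    then have d0: "d > 0" using l by (auto intro: Nat.gr0I)
    \<comment> \<open>Taking the complementary divisor, \<open>e = l div k\<close>, is its own
      inverse and matches the \<open>k\<close> between \<open>d\<close> and \<open>l\<close> in
      divisibility with the divisors of \<open>l div d\<close>.\<close>
    have "(\<Sum>k | k \<in> ?D \<and> d dvd k. ?mu k) = (\<Sum>e | e dvd l div d. of_int (moebius_mu e))"
      by (rule sum.reindex_bij_witness[where i = "\<lambda>e. l div e" and j = "\<lambda>k. l div k"])
        (use d d0 l in \<open>auto elim!: dvdE\<close>)
    also have "\<dots> = of_int (\<Sum>e | e dvd l div d. moebius_mu e)" by simp
    also have "\<dots> = (if l div d = 1 then 1 else 0)"
      using d d0 l by (subst sum_moebius_mu_divisors) (auto elim!: dvdE)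
    also have "l div d = 1 \<longleftrightarrow> d = l" using d d0 l by (auto elim!: dvdE)
    finally show "(\<Sum>k | k \<in> ?D \<and> d dvd k. ?mu k * f d) = (if d = l then f d else 0)"
      by (simp flip: sum_distrib_right)
  qed
  also have "\<dots> = f l" using fin by simp
  finally show ?thesis .
qed

section \<open>Inverting the fixed point formula\<close>

text \<open>Finite multiplicity makes every summand finite, so the divisor sum becomes an identity
  of natural numbers that can be read in the reals.\<close>

lemma fixed_point_count_eq_enat:
  assumes "\<sigma> permutes X" and "finite_multiplicity X \<sigma>" and "l \<ge> 1"
  shows "fixed_point_count X (\<sigma> ^^ l)
    = enat (\<Sum>k | k dvd l. k * the_enat (cycle_count X \<sigma> (enat k)))"
proof -
  have "enat k * cycle_count X \<sigma> (enat k) = enat (k * the_enat (cycle_count X \<sigma> (enat k)))"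
    if "k dvd l" for k
  proof -
    have "k \<ge> 1" using that assms(3) by (cases k) auto
    then show ?thesis using assms(2) by (fastforce simp: finite_multiplicity_def)
  qed
  then have "fixed_point_count X (\<sigma> ^^ l)
      = (\<Sum>k | k dvd l. enat (k * the_enat (cycle_count X \<sigma> (enat k))))"
    unfolding fixed_point_count_eq_divisor_sum[OF assms(1,3)] by (intro sum.cong) auto
  then show ?thesis by (simp only: of_nat_eq_enat[symmetric] of_nat_sum)
qed

text \<open>Inversion is applied with \<open>f k\<close> equal to \<open>k\<close> times the number
  of cycles of length \<open>k\<close>, and \<open>g\<close> the fixed point counts; the factor
  \<open>l\<close> is then divided out.\<close>

lemma cycle_count_eq_moebius_sum:
  assumes "\<sigma> permutes X" and "finite_multiplicity X \<sigma>" and "l \<ge> 1"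
  shows "real (the_enat (cycle_count X \<sigma> (enat l))) = 1 / real l *
    (\<Sum>k | k dvd l. of_int (moebius_mu (l div k)) * real (the_enat (fixed_point_count X (\<sigma> ^^ k))))"
proof -
  have "(\<Sum>k | k dvd l. of_int (moebius_mu (l div k))
      * real (the_enat (fixed_point_count X (\<sigma> ^^ k))))
    = real (l * the_enat (cycle_count X \<sigma> (enat l)))"
    by (rule moebius_inversion) (use assms in \<open>simp_all add: fixed_point_count_eq_enat\<close>)
  then show ?thesis using assms(3) by simp
qed

theorem theorem2:
  fixes X :: "'a set"
  assumes "X \<noteq> {}" and "countable X"
  shows
    "(\<forall>\<sigma>. \<sigma> permutes X \<and> finite_type X \<sigma> \<longrightarrow>
        (\<forall>l::nat. l \<ge> 1 \<longrightarrow>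
          fixed_point_count X (\<sigma> ^^ l) =
            (\<Sum>k | k \<in> {1..l} \<and> k dvd l. enat k * cycle_count X \<sigma> (enat k)))) \<and>
     (\<forall>\<sigma>. \<sigma> permutes X \<and> finite_type X \<sigma> \<and> finite_multiplicity X \<sigma> \<longrightarrow>
        (\<forall>l::nat. l \<ge> 1 \<longrightarrow>
          (\<forall>k. k \<in> {1..l} \<and> k dvd l \<longrightarrow> fixed_point_count X (\<sigma> ^^ k) \<noteq> \<infinity>) \<and>
          real (the_enat (cycle_count X \<sigma> (enat l))) =
            1 / real l * (\<Sum>k | k \<in> {1..l} \<and> k dvd l.
              of_int (moebius_mu (l div k)) * real (the_enat (fixed_point_count X (\<sigma> ^^ k)))))) \<and>
     (\<forall>\<sigma> \<tau>. \<sigma> permutes X \<and> finite_type X \<sigma> \<and> finite_multiplicity X \<sigma> \<and>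
        \<tau> permutes X \<and> finite_type X \<tau> \<and> finite_multiplicity X \<tau> \<and>
        (\<forall>k::nat. k \<ge> 1 \<longrightarrow> fixed_point_count X (\<sigma> ^^ k) = fixed_point_count X (\<tau> ^^ k)) \<longrightarrow>
        conjugate X \<sigma> \<tau>)"
proof -
  \<comment> \<open>Reconciles the index range of the stated sums with that of the lemmas; a
    positive \<open>l\<close> excludes the divisor 0.\<close>
  have divisors: "{k. k \<in> {1..l} \<and> k dvd l} = {k. k dvd l}" if "l \<ge> 1" for l :: nat
    using that by (auto intro: dvd_imp_le Nat.gr0I simp: Suc_le_eq)
  have conj: "conjugate X \<sigma> \<tau>"
    if \<sigma>: "\<sigma> permutes X" "finite_type X \<sigma>" "finite_multiplicity X \<sigma>"
      and \<tau>: "\<tau> permutes X" "finite_type X \<tau>" "finite_multiplicity X \<tau>"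
      and eq: "\<And>k::nat. k \<ge> 1 \<Longrightarrow> fixed_point_count X (\<sigma> ^^ k) = fixed_point_count X (\<tau> ^^ k)"
    for \<sigma> \<tau>
    unfolding conjugate_def
  proof (intro allI impI)
    fix m :: enat assume m: "m \<ge> 1"
    show "cycle_count X \<sigma> m = cycle_count X \<tau> m"
    proof (cases m)
      case (enat l)
      then have l: "l \<ge> 1" using m by (simp add: one_enat_def)
      have "fixed_point_count X (\<sigma> ^^ k) = fixed_point_count X (\<tau> ^^ k)" if "k dvd l" for k
        using that l eq[of k] by (cases k) auto
      then have "real (the_enat (cycle_count X \<sigma> m)) = real (the_enat (cycle_count X \<tau> m))"
        unfolding enat cycle_count_eq_moebius_sum[OF \<sigma>(1,3) l]
          cycle_count_eq_moebius_sum[OF \<tau>(1,3) l] by simp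
      \<comment> \<open>\<open>the_enat\<close> is unspecified at infinity, so finiteness is what
        lifts the equality back to \<open>enat\<close>.\<close>
      moreover have "cycle_count X \<sigma> m \<noteq> \<infinity>" "cycle_count X \<tau> m \<noteq> \<infinity>"
        using \<sigma>(3) \<tau>(3) l enat by (auto simp: finite_multiplicity_def)
      ultimately show ?thesis by auto
    next
      case infinity
      \<comment> \<open>Fixed point counts do not detect infinite cycles; finite type makes both
        counts 0.\<close>
      then show ?thesis using \<sigma>(2) \<tau>(2) by (simp add: finite_type_def)
    qed
  qed
  show ?thesis
  proof (intro conjI allI impI; (elim conjE)?)
    fix \<sigma> :: "'a \<Rightarrow> 'a" and l :: nat
    assume "\<sigma> permutes X" "l \<ge> 1"
    then show "fixed_point_count X (\<sigma> ^^ l) =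
        (\<Sum>k | k \<in> {1..l} \<and> k dvd l. enat k * cycle_count X \<sigma> (enat k))"
      unfolding divisors[OF \<open>l \<ge> 1\<close>] by (rule fixed_point_count_eq_divisor_sum)
  next
    fix \<sigma> :: "'a \<Rightarrow> 'a" and l k :: nat
    assume "\<sigma> permutes X" "finite_multiplicity X \<sigma>" "k \<in> {1..l}"
    then show "fixed_point_count X (\<sigma> ^^ k) \<noteq> \<infinity>"
      by (simp add: fixed_point_count_eq_enat)
  next
    fix \<sigma> :: "'a \<Rightarrow> 'a" and l :: nat
    assume "\<sigma> permutes X" "finite_multiplicity X \<sigma>" "l \<ge> 1"
    then show "real (the_enat (cycle_count X \<sigma> (enat l))) =
        1 / real l * (\<Sum>k | k \<in> {1..l} \<and> k dvd l.
          of_int (moebius_mu (l div k)) * real (the_enat (fixed_point_count X (\<sigma> ^^ k))))"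
      unfolding divisors[OF \<open>l \<ge> 1\<close>] by (rule cycle_count_eq_moebius_sum)
  qed (use conj in blast)
qed

end
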